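(* For the downlink pinching-antenna system with $N$ pinching antennas, total transmit power $P$ and fixed minimum spacing $\Delta$, $$\lim_{N\to\infty}\mathcal R_{\mathrm M,\mathrm T}^{\mathrm D}=\lim_{N\to\infty}\mathcal R_{\mathrm M,\mathrm F}^{\mathrm D}=\lim_{N\to\infty}\mathcal C_{\mathrm M}^{\mathrm D}=\{(0,0)\}.$$
   Context: Setting. For fixed $\eta,\sigma^2,d,k_0,\lambda_{\mathrm g},\Delta,P>0$, $y_{\mathrm p},q_0\in\mathbb R$ and fixed users at $[x_k,y_k,0]^{\mathsf T}$, $k=1,2$, put $d_k^2=d^2+(y_k-y_{\mathrm p})^2$. For each integer $N>1$ the feasible set is $\mathcal P=\{\mathbf q=(q_1,\dots,q_N)\in\mathbb R^N:|q_n-q_{n'}|\ge\Delta\ \forall n\ne n'\}$. The effective channel of user $k$ is $$h_k(\mathbf q)=\frac1{\sqrt N}\sum_{n=1}^N\frac{\sqrt\eta\,e^{-\mathrm jk_0\sqrt{d_k^2+(x_k-q_n)^2}}}{\sqrt{d_k^2+(x_k-q_n)^2}}\,e^{-\mathrm j2\pi|q_n-q_0|/\lambda_{\mathrm g}}.$$ $\mathrm{Conv}$ denotes the convex hull. For uplink powers $P_1,P_2\ge0$ define the (dual) uplink regions: $\mathcal C_{\mathrm M}^{\mathrm U}=\mathrm{Conv}(\bigcup_{\mathbf q\in\mathcal P}\mathcal C^{\mathrm U}(\mathbf q))$, where $\mathcal C^{\mathrm U}(\mathbf q)$ is the set of $(R_1,R_2)$ with $0\le R_k\le\log_2(1+P_k|h_k(\mathbf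 q)|^2/\sigma^2)$, $k=1,2$, and $R_1+R_2\le\log_2(1+(P_1|h_1(\mathbf q)|^2+P_2|h_2(\mathbf q)|^2)/\sigma^2)$; $\mathcal R_{\mathrm M,\mathrm T}^{\mathrm U}=\bigcup_{\rho\in[0,1]}\{(R_1,R_2):0\le R_1\le\rho\,\bar r_1,\ 0\le R_2\le(1-\rho)\,\bar r_2\}$, where $\bar r_k=\sup_{\mathbf q\in\mathcal P}\log_2(1+P_k|h_k(\mathbf q)|^2/\sigma^2)$; $\mathcal R_{\mathrm M,\mathrm F}^{\mathrm U}=\mathrm{Conv}(\bigcup_{\mathbf q\in\mathcal P}\bigcup_{\rho\in[0,1]}\{(R_1,R_2):0\le R_k\le R_k^\rho(\mathbf q),\ k=1,2\})$ with $R_1^\rho(\mathbf q)=\rho\log_2(1+\frac{P_1|h_1(\mathbf q)|^2}{\rho\sigma^2})$, $R_2^\rho(\mathbf q)=(1-\rho)\log_2(1+\frac{P_2|h_2(\mathbf q)|^2}{(1-\rho)\sigma^2})$, $R_1^0\equiv0$, $R_2^1\equiv0$. The downlink regions are, via uplink-downlink duality, $\mathcal C_{\mathrm M}^{\mathrm D}$, $\mathcal R_{\mathrm M,\mathrm T}^{\mathrm D}$, $\mathcal R_{\mathrm M,\mathrm F}^{\mathrm D}$, each defined as $\mathrm{Conv}(\bigcup_{P_1+P_2=P}\,\cdot\,)$ of the corresponding uplink region, the union being over all $P_1,P_2\ge0$ with $P_1+P_2=P$. All regions depend on $N$. The statement $\lim_{N\to\infty}\mathcal A_N=\{(0,0)\}$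 for regions $\mathcal A_N\subseteq[0,\infty)^2$ containing $(0,0)$ means: for every $\varepsilon>0$ there is $N_0$ such that $\mathcal A_N\subseteq[0,\varepsilon]^2$ for all $N\ge N_0$. *)

theory Defs
  imports "HOL-Analysis.Analysis"
begin

text \<open>
  User positions \<open>(user_x k, user_y k, 0)\<close> and channels are indexed by \<open>k \<in> {1, 2}\<close>;
  no other index is used. The field \<open>noise\<close> is the noise power \<open>\<sigma>\<^sup>2\<close>, not its square root.
\<close>

record pinching_system =
  eta :: real
  noise :: real
  height :: real
  wavenumber :: real
  guide_wavelength :: real
  spacing :: real
  total_power :: real
  guide_y :: real
  feed :: real
  user_x :: "nat \<Rightarrow> real"
  user_y :: "nat \<Rightarrow> real"

definition valid_system :: "pinching_system \<Rightarrow> bool" where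
  "valid_system S \<longleftrightarrow>
     eta S > 0 \<and> noise S > 0 \<and> height S > 0 \<and> wavenumber S > 0 \<and>
     guide_wavelength S > 0 \<and> spacing S > 0 \<and> total_power S > 0"

text \<open>Vectors in \<open>\<real>\<^sup>N\<close> are represented as extensional functions on \<open>{1..N}\<close>.\<close>

definition feasible :: "pinching_system \<Rightarrow> nat \<Rightarrow> (nat \<Rightarrow> real) set" where
  "feasible S N =
     {q \<in> {1..N} \<rightarrow>\<^sub>E UNIV. \<forall>n\<in>{1..N}. \<forall>n'\<in>{1..N}. n \<noteq> n' \<longrightarrow> \<bar>q n - q n'\<bar> \<ge> spacing S}"

definition user_dist :: "pinching_system \<Rightarrow> nat \<Rightarrow> real" where
  "user_dist S k = sqrt ((height S)\<^sup>2 + (user_y S k - guide_y S)\<^sup>2)"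

definition antenna_dist :: "pinching_system \<Rightarrow> nat \<Rightarrow> real \<Rightarrow> real" where
  "antenna_dist S k t = sqrt ((user_dist S k)\<^sup>2 + (user_x S k - t)\<^sup>2)"

definition channel :: "pinching_system \<Rightarrow> nat \<Rightarrow> nat \<Rightarrow> (nat \<Rightarrow> real) \<Rightarrow> complex" where
  "channel S N k q =
     1 / of_real (sqrt (real N)) *
     (\<Sum>n=1..N.
        of_real (sqrt (eta S)) * exp (- \<i> * of_real (wavenumber S * antenna_dist S k (q n)))
          / of_real (antenna_dist S k (q n))
        * exp (- \<i> * of_real (2 * pi * \<bar>q n - feed S\<bar> / guide_wavelength S)))"

definition channel_gain :: "pinching_system \<Rightarrow> nat \<Rightarrow> nat \<Rightarrow> (nat \<Rightarrow> real) \<Rightarrow> real" where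
  "channel_gain S N k q = (cmod (channel S N k q))\<^sup>2"

definition user_rate :: "pinching_system \<Rightarrow> nat \<Rightarrow> nat \<Rightarrow> real \<Rightarrow> (nat \<Rightarrow> real) \<Rightarrow> real" where
  "user_rate S N k Pk q = log 2 (1 + Pk * channel_gain S N k q / noise S)"

definition uplink_capacity_at ::
  "pinching_system \<Rightarrow> nat \<Rightarrow> real \<Rightarrow> real \<Rightarrow> (nat \<Rightarrow> real) \<Rightarrow> (real \<times> real) set" where
  "uplink_capacity_at S N P1 P2 q =
     {(R1, R2). 0 \<le> R1 \<and> R1 \<le> user_rate S N 1 P1 q \<and>
                0 \<le> R2 \<and> R2 \<le> user_rate S N 2 P2 q \<and>
                R1 + R2 \<le> log 2 (1 + (P1 * channel_gain S N 1 q + P2 * channel_gain S N 2 q) / noise S)}"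

definition uplink_capacity ::
  "pinching_system \<Rightarrow> nat \<Rightarrow> real \<Rightarrow> real \<Rightarrow> (real \<times> real) set" where
  "uplink_capacity S N P1 P2 = convex hull (\<Union>q\<in>feasible S N. uplink_capacity_at S N P1 P2 q)"

text \<open>
  For a valid system and \<open>Pk \<ge> 0\<close> the supremum ranges over a nonempty bounded set, since
  \<open>cmod (channel S N k q) \<le> sqrt (N * eta S) / user_dist S k\<close>.
\<close>

definition best_rate :: "pinching_system \<Rightarrow> nat \<Rightarrow> nat \<Rightarrow> real \<Rightarrow> real" where
  "best_rate S N k Pk = (SUP q\<in>feasible S N. user_rate S N k Pk q)"

definition uplink_tdma ::
  "pinching_system \<Rightarrow> nat \<Rightarrow> real \<Rightarrow> real \<Rightarrow> (real \<times> real) set" where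
  "uplink_tdma S N P1 P2 =
     (\<Union>\<rho>\<in>{0..1}. {(R1, R2). 0 \<le> R1 \<and> R1 \<le> \<rho> * best_rate S N 1 P1 \<and>
                              0 \<le> R2 \<and> R2 \<le> (1 - \<rho>) * best_rate S N 2 P2})"

text \<open>Rate of user \<open>k\<close> when it is allotted the fraction \<open>\<theta>\<close> of the bandwidth.\<close>

definition fdma_rate ::
  "pinching_system \<Rightarrow> nat \<Rightarrow> nat \<Rightarrow> real \<Rightarrow> real \<Rightarrow> (nat \<Rightarrow> real) \<Rightarrow> real" where
  "fdma_rate S N k Pk \<theta> q =
     (if \<theta> = 0 then 0 else \<theta> * log 2 (1 + Pk * channel_gain S N k q / (\<theta> * noise S)))"

definition uplink_fdma ::
  "pinching_system \<Rightarrow> nat \<Rightarrow> real \<Rightarrow> real \<Rightarrow> (real \<times> real) set" where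
  "uplink_fdma S N P1 P2 = convex hull
     (\<Union>q\<in>feasible S N. \<Union>\<rho>\<in>{0..1}.
        {(R1, R2). 0 \<le> R1 \<and> R1 \<le> fdma_rate S N 1 P1 \<rho> q \<and>
                   0 \<le> R2 \<and> R2 \<le> fdma_rate S N 2 P2 (1 - \<rho>) q})"

definition downlink ::
  "pinching_system \<Rightarrow> (real \<Rightarrow> real \<Rightarrow> (real \<times> real) set) \<Rightarrow> (real \<times> real) set" where
  "downlink S U = convex hull
     (\<Union>(P1, P2)\<in>{(P1, P2). 0 \<le> P1 \<and> 0 \<le> P2 \<and> P1 + P2 = total_power S}. U P1 P2)"

definition downlink_capacity :: "pinching_system \<Rightarrow> nat \<Rightarrow> (real \<times> real) set" where
  "downlink_capacity S N = downlink S (uplink_capacity S N)"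

definition downlink_tdma :: "pinching_system \<Rightarrow> nat \<Rightarrow> (real \<times> real) set" where
  "downlink_tdma S N = downlink S (uplink_tdma S N)"

definition downlink_fdma :: "pinching_system \<Rightarrow> nat \<Rightarrow> (real \<times> real) set" where
  "downlink_fdma S N = downlink S (uplink_fdma S N)"

text \<open>
  The limit of regions being \<open>{(0, 0)}\<close> is a notion for subsets of the nonnegative quadrant that
  contain the origin, defined for \<open>N > 1\<close>; the first conjunct records that, and in particular
  excludes empty regions.
\<close>

definition shrinks_to_origin :: "(nat \<Rightarrow> (real \<times> real) set) \<Rightarrow> bool" where
  "shrinks_to_origin A \<longleftrightarrow>
     (\<forall>N>1. (0, 0) \<in> A N \<and> A N \<subseteq> {0..} \<times> {0..}) \<and>
     (\<forall>\<epsilon>>0. \<exists>N0. \<forall>N\<ge>N0. A N \<subseteq> {0..\<epsilon>} \<times> {0..\<epsilon>})"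

end

theory Submission
  imports Defs "HOL-Real_Asymp.Real_Asymp"
begin

text \<open>
  Since the antennas are \<open>\<Delta>\<close>-separated, the cells \<open>\<lfloor>(q\<^sub>n - x\<^sub>k) / \<Delta>\<rfloor>\<close> are pairwise distinct
  integers, and an antenna in cell \<open>j\<close> contributes \<open>O(1 / (1 + \<bar>j\<bar>))\<close> to the channel amplitude. Hence the
  unnormalised amplitude grows at most like the harmonic numbers, and after division by
  \<open>\<surd>N\<close> the channel gain is \<open>O((log N)\<^sup>2 / N)\<close>, uniformly over all feasible placements. Every
  rate is at most a constant times the gain, so each region lies in a box of vanishing size.
\<close>

section \<open>Harmonic bounds for sums over distinct integers\<close>

text \<open>Instead of rearranging \<open>J\<close> around 0, split it at absolute value
  \<open>N\<close>. The near integers are dominated by the complete two-sided harmonic sum; the far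
  ones number at most \<open>N\<close> and contribute at most \<open>1 / (1 + N)\<close> each, hence
  at most 1 together.\<close>

lemma sum_inverse_abs_int_le_harm:
  fixes J :: "int set"
  assumes "finite J" "card J \<le> N"
  shows "(\<Sum>j\<in>J. 1 / (1 + \<bar>real_of_int j\<bar>)) \<le> 1 + 2 * harm (Suc N)"
proof -
  let ?f = "\<lambda>j. 1 / (1 + \<bar>real_of_int j\<bar>)"
  let ?I = "{- int N..int N}"
  let ?A = "int ` {..N}" and ?B = "(\<lambda>i. - int i) ` {..N}"
  have harm: "(\<Sum>i\<le>N. 1 / (1 + real i)) = harm (Suc N)"
    unfolding harm_altdef lessThan_Suc_atMost by (simp add: field_simps)
  have "sum ?f (J \<inter> ?I) \<le> sum ?f (?A \<union> ?B)"
  proof (rule sum_mono2)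
    show "J \<inter> ?I \<subseteq> ?A \<union> ?B"
    proof
      fix j assume "j \<in> J \<inter> ?I"
      then have "j = int (nat j) \<and> nat j \<le> N \<or> j = - int (nat (- j)) \<and> nat (- j) \<le> N"
        by auto
      then show "j \<in> ?A \<union> ?B" by blast
    qed
  qed auto
  \<comment> \<open>Both images contain 0, so the sums overlap there; the doubly counted term is
    nonnegative.\<close>
  also have "\<dots> \<le> sum ?f ?A + sum ?f ?B"
    by (subst sum.union_inter [symmetric]) (auto intro!: sum_nonneg)
  also have "sum ?f ?A = harm (Suc N)"
    by (subst sum.reindex) (auto simp: inj_on_def harm)
  also have "sum ?f ?B = harm (Suc N)"
    by (subst sum.reindex) (auto simp: inj_on_def harm)
  finally have near: "sum ?f (J \<inter> ?I) \<le> 2 * harm (Suc N)" by simp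
  have "sum ?f (J - ?I) \<le> real (card (J - ?I)) * (1 / (1 + real N))"
  proof (rule sum_bounded_above)
    fix j assume "j \<in> J - ?I"
    then have "int N \<le> \<bar>j\<bar>" by auto
    then have "real N \<le> \<bar>real_of_int j\<bar>" by linarith
    then show "?f j \<le> 1 / (1 + real N)" by (simp add: frac_le)
  qed
  also have "\<dots> \<le> 1"
  proof -
    have "card (J - ?I) \<le> N"
      using assms card_mono [of J "J - ?I"] by auto
    then show ?thesis by (simp add: divide_simps)
  qed
  finally have far: "sum ?f (J - ?I) \<le> 1" .
  have "sum ?f J = sum ?f (J \<inter> ?I) + sum ?f (J - ?I)"
    using assms by (subst sum.Int_Diff [of J _ ?I]) auto
  with near far show ?thesis by simp
qed

text \<open>The sequence \<open>harm n - ln n\<close> decreases and has value 1 at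
  \<open>n = 1\<close>.\<close>

lemma harm_Suc_le_ln: "harm (Suc n) \<le> 1 + ln (real (Suc n))"
  using euler_mascheroni_sequence_decreasing [of 1 "Suc n"] by (simp add: harm_def)

context
  fixes S :: pinching_system
  assumes valid: "valid_system S"
begin

section \<open>Uniform bound on the channel gain\<close>

text \<open>Chosen so that \<open>2 + \<bar>u\<bar> \<le> amplitude_const * D\<close> for an antenna
  at distance \<open>D\<close> and normalised offset \<open>u\<close>: the first summand absorbs the
  2 through \<open>height S \<le> D\<close>, the second absorbs the offset through
  \<open>\<bar>u\<bar> \<le> D / spacing S\<close>.\<close>

definition amplitude_const :: real where
  "amplitude_const = 2 / height S + 1 / spacing S"

lemma amplitude_const_pos: "0 < amplitude_const"
  using valid by (auto simp: amplitude_const_def valid_system_def intro: add_pos_pos)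

lemma height_le_antenna_dist: "height S \<le> antenna_dist S k t"
proof -
  have "(height S)\<^sup>2 \<le> (user_dist S k)\<^sup>2 + (user_x S k - t)\<^sup>2"
    by (simp add: user_dist_def)
  then show ?thesis
    unfolding antenna_dist_def by (rule real_le_rsqrt)
qed

lemma inverse_antenna_dist_le:
  "1 / antenna_dist S k t
     \<le> amplitude_const * (1 / (1 + \<bar>real_of_int \<lfloor>(t - user_x S k) / spacing S\<rfloor>\<bar>))"
proof -
  define D where "D = antenna_dist S k t"
  define u where "u = (t - user_x S k) / spacing S"
  have pos: "height S > 0" "spacing S > 0"
    using valid by (auto simp: valid_system_def)
  have D: "height S \<le> D" "D > 0"
    using height_le_antenna_dist [of k t] pos by (auto simp: D_def)
  have "\<bar>t - user_x S k\<bar> \<le> D"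
    unfolding D_def antenna_dist_def
    by (rule real_le_rsqrt) (simp add: power2_commute)
  then have u: "\<bar>u\<bar> \<le> D / spacing S"
    using pos by (simp add: u_def abs_divide divide_right_mono)
  \<comment> \<open>Taking the floor increases the absolute value by at most 1.\<close>
  have "1 + \<bar>real_of_int \<lfloor>u\<rfloor>\<bar> \<le> 2 + \<bar>u\<bar>" by linarith
  also have "\<dots> \<le> 2 * (D / height S) + D / spacing S"
    using u D pos by (intro add_mono) (auto simp: field_simps)
  also have "\<dots> = amplitude_const * D"
    by (simp add: amplitude_const_def algebra_simps)
  finally have "1 + \<bar>real_of_int \<lfloor>u\<rfloor>\<bar> \<le> amplitude_const * D" .
  then show ?thesis
    using D by (simp add: u_def [symmetric] D_def [symmetric] field_simps)
qed

text \<open>Reals with equal floor differ by strictly less than 1, so two antennas sharing a cell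
  would be closer than \<open>spacing S\<close>.\<close>

lemma inj_on_cell:
  assumes "q \<in> feasible S N"
  shows "inj_on (\<lambda>n. \<lfloor>(q n - x) / spacing S\<rfloor>) {1..N}"
proof (rule inj_onI, rule ccontr)
  fix m n
  assume mn: "m \<in> {1..N}" "n \<in> {1..N}" "m \<noteq> n"
    and eq: "\<lfloor>(q m - x) / spacing S\<rfloor> = \<lfloor>(q n - x) / spacing S\<rfloor>"
  have pos: "spacing S > 0" using valid by (auto simp: valid_system_def)
  have "\<bar>(q m - x) / spacing S - (q n - x) / spacing S\<bar> < 1"
    using eq by linarith
  then have "\<bar>(q m - q n) / spacing S\<bar> < 1"
    by (simp add: diff_divide_distrib)
  then have "\<bar>q m - q n\<bar> < spacing S"
    using pos by (simp add: abs_divide)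
  moreover have "spacing S \<le> \<bar>q m - q n\<bar>"
    using assms mn by (auto simp: feasible_def)
  ultimately show False by simp
qed

lemma sum_inverse_antenna_dist_le:
  assumes "q \<in> feasible S N"
  shows "(\<Sum>n=1..N. 1 / antenna_dist S k (q n)) \<le> amplitude_const * (1 + 2 * harm (Suc N))"
proof -
  let ?c = "\<lambda>n. \<lfloor>(q n - user_x S k) / spacing S\<rfloor>"
  have "(\<Sum>n=1..N. 1 / antenna_dist S k (q n))
      \<le> (\<Sum>n=1..N. amplitude_const * (1 / (1 + \<bar>real_of_int (?c n)\<bar>)))"
    by (intro sum_mono inverse_antenna_dist_le)
  \<comment> \<open>Injectivity of the cell map turns the sum over antennas into a sum over a set of
    integers.\<close>
  also have "\<dots> = amplitude_const * (\<Sum>j\<in>?c ` {1..N}. 1 / (1 + \<bar>real_of_int j\<bar>))"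
    by (subst sum.reindex [OF inj_on_cell [OF assms]]) (simp add: sum_distrib_left)
  also have "\<dots> \<le> amplitude_const * (1 + 2 * harm (Suc N))"
    using amplitude_const_pos card_image_le [of "{1..N}" ?c]
    by (intro mult_left_mono sum_inverse_abs_int_le_harm) auto
  finally show ?thesis .
qed

text \<open>Free of both the placement and the user index, because \<open>height S\<close> bounds
  the distances to either user from below; one box therefore serves both rate coordinates.\<close>

definition gain_bound :: "nat \<Rightarrow> real" where
  "gain_bound N = eta S * amplitude_const\<^sup>2 * (1 + 2 * harm (Suc N))\<^sup>2 / real N"

text \<open>Triangle inequality: all phase factors have modulus 1, so the bound is the amplitude of
  fully coherent addition.\<close>

lemma cmod_channel_le:
  "cmod (channel S N k q) \<le> sqrt (eta S) / sqrt (real N) * (\<Sum>n=1..N. 1 / antenna_dist S k (q n))"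
proof -
  have eta: "eta S > 0" and h: "height S > 0"
    using valid by (auto simp: valid_system_def)
  have pos: "antenna_dist S k t > 0" for t
    using height_le_antenna_dist [of k t] h by linarith
  have unit: "cmod (exp (- \<i> * of_real x)) = 1" for x :: real
    by simp
  have "cmod (channel S N k q) \<le> 1 / sqrt (real N) * (\<Sum>n=1..N. sqrt (eta S) * (1 / antenna_dist S k (q n)))"
    unfolding channel_def norm_mult
  proof (rule mult_mono)
    show "cmod (\<Sum>n=1..N. of_real (sqrt (eta S)) * exp (- \<i> * of_real (wavenumber S * antenna_dist S k (q n)))
          / of_real (antenna_dist S k (q n))
        * exp (- \<i> * of_real (2 * pi * \<bar>q n - feed S\<bar> / guide_wavelength S)))
       \<le> (\<Sum>n=1..N. sqrt (eta S) * (1 / antenna_dist S k (q n)))"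
      using eta pos
      by (intro sum_norm_le) (simp only: norm_mult norm_divide unit norm_of_real, simp add: less_imp_le)
  qed (auto simp: norm_divide)
  then show ?thesis by (simp add: sum_distrib_left)
qed

lemma channel_gain_le:
  assumes "q \<in> feasible S N"
  shows "channel_gain S N k q \<le> gain_bound N"
proof -
  have eta: "eta S > 0" using valid by (auto simp: valid_system_def)
  have "cmod (channel S N k q) \<le> sqrt (eta S) / sqrt (real N) * (amplitude_const * (1 + 2 * harm (Suc N)))"
    using sum_inverse_antenna_dist_le [OF assms] eta
    by (intro order.trans [OF cmod_channel_le] mult_left_mono) auto
  then have "(cmod (channel S N k q))\<^sup>2
      \<le> (sqrt (eta S) / sqrt (real N) * (amplitude_const * (1 + 2 * harm (Suc N))))\<^sup>2"
    by (intro power_mono) auto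
  then show ?thesis
    using eta by (simp add: channel_gain_def gain_bound_def power_mult_distrib power_divide)
qed

lemma channel_gain_nonneg: "0 \<le> channel_gain S N k q"
  by (simp add: channel_gain_def)

section \<open>A vanishing bound on all single-user rates\<close>

text \<open>The linearisation \<open>log 2 (1 + x) \<le> x / ln 2\<close>, evaluated at full power
  and the largest admissible gain.\<close>

definition rate_bound :: "nat \<Rightarrow> real" where
  "rate_bound N = total_power S * gain_bound N / noise S / ln 2"

lemma rate_bound_tendsto_0: "rate_bound \<longlonglongrightarrow> 0"
proof -
  define K where "K = total_power S * eta S * amplitude_const\<^sup>2 / noise S / ln 2"
  have K: "K > 0"
    using valid amplitude_const_pos by (auto simp: K_def valid_system_def)
  have eq: "rate_bound N = K * ((1 + 2 * harm (Suc N))\<^sup>2 / real N)" for N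
    by (simp add: rate_bound_def gain_bound_def K_def mult_ac)
  show ?thesis
  proof (rule tendsto_sandwich)
    show "\<forall>\<^sub>F N in sequentially. 0 \<le> rate_bound N"
      using K by (auto simp: eq)
    \<comment> \<open>The 3 arises from \<open>1 + 2 * (1 + ln (real (Suc N)))\<close>.\<close>
    show "\<forall>\<^sub>F N in sequentially. rate_bound N \<le> K * ((3 + 2 * ln (real (Suc N)))\<^sup>2 / real N)"
    proof (rule always_eventually, rule allI)
      fix N
      have "0 \<le> (harm (Suc N) :: real)" by (rule harm_nonneg)
      then have "(1 + 2 * harm (Suc N))\<^sup>2 \<le> (3 + 2 * ln (real (Suc N)))\<^sup>2"
        using harm_Suc_le_ln [of N] by (intro power_mono) auto
      then show "rate_bound N \<le> K * ((3 + 2 * ln (real (Suc N)))\<^sup>2 / real N)"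
        using K unfolding eq by (intro mult_left_mono divide_right_mono) auto
    qed
    have "(\<lambda>N. (3 + 2 * ln (real (Suc N)))\<^sup>2 / real N) \<longlonglongrightarrow> 0" by real_asymp
    then show "(\<lambda>N. K * ((3 + 2 * ln (real (Suc N)))\<^sup>2 / real N)) \<longlonglongrightarrow> 0"
      by (rule tendsto_mult_right_zero)
  qed simp
qed

text \<open>Equally spaced antennas are feasible. This makes the supremum in
  \<open>best_rate\<close> range over a nonempty set and supplies a placement witnessing that the
  regions contain the origin.\<close>

lemma feasible_nonempty: "feasible S N \<noteq> {}"
proof -
  have pos: "spacing S > 0" using valid by (auto simp: valid_system_def)
  have "spacing S \<le> \<bar>real m * spacing S - real n * spacing S\<bar>" if "m \<noteq> n" for m n :: nat
  proof -
    have "1 \<le> \<bar>real m - real n\<bar>" using that by linarith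
    then have "spacing S \<le> \<bar>real m - real n\<bar> * spacing S" using pos by simp
    also have "\<dots> = \<bar>real m * spacing S - real n * spacing S\<bar>"
      using pos by (simp add: abs_mult left_diff_distrib [symmetric])
    finally show ?thesis .
  qed
  then have "restrict (\<lambda>n. real n * spacing S) {1..N} \<in> feasible S N"
    by (auto simp: feasible_def)
  then show ?thesis by blast
qed

lemma user_rate_nonneg:
  assumes "0 \<le> Pk"
  shows "0 \<le> user_rate S N k Pk q"
proof -
  have "0 \<le> Pk * channel_gain S N k q / noise S"
    using assms valid channel_gain_nonneg [of N k q] by (simp add: valid_system_def)
  then show ?thesis by (simp add: user_rate_def)
qed

lemma fdma_rate_nonneg:
  assumes "0 \<le> Pk" "0 \<le> \<theta>"
  shows "0 \<le> fdma_rate S N k Pk \<theta> q"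
proof -
  have "0 \<le> Pk * channel_gain S N k q / (\<theta> * noise S)"
    using assms valid channel_gain_nonneg [of N k q] by (simp add: valid_system_def)
  then show ?thesis using assms by (simp add: fdma_rate_def)
qed

text \<open>By \<open>ln (1 + x) \<le> x\<close> the factor \<open>\<theta>\<close> cancels against
  the one dividing the noise power, so the bound is uniform in the bandwidth fraction.\<close>

lemma fdma_rate_le:
  assumes "q \<in> feasible S N" "0 \<le> Pk" "Pk \<le> total_power S" "0 \<le> \<theta>"
  shows "fdma_rate S N k Pk \<theta> q \<le> rate_bound N"
proof -
  let ?g = "channel_gain S N k q"
  have noise: "noise S > 0" using valid by (auto simp: valid_system_def)
  have le: "Pk * ?g / noise S / ln 2 \<le> rate_bound N"
    unfolding rate_bound_def
    using assms noise channel_gain_nonneg [of N k q] channel_gain_le [OF assms(1), of k]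
    by (intro divide_right_mono mult_mono) auto
  have nonneg: "0 \<le> Pk * ?g / noise S / ln 2"
    using assms noise channel_gain_nonneg [of N k q] by simp
  show ?thesis
  proof (cases "\<theta> = 0")
    case True
    with le nonneg show ?thesis by (simp add: fdma_rate_def)
  next
    case False
    with assms have th: "\<theta> > 0" by simp
    have "ln (1 + Pk * ?g / (\<theta> * noise S)) \<le> Pk * ?g / (\<theta> * noise S)"
      using assms th noise channel_gain_nonneg [of N k q] by (intro ln_add_one_self_le_self) simp
    then have "\<theta> * (ln (1 + Pk * ?g / (\<theta> * noise S)) / ln 2) \<le> \<theta> * (Pk * ?g / (\<theta> * noise S) / ln 2)"
      using th by (intro mult_left_mono divide_right_mono) auto
    also have "\<dots> = Pk * ?g / noise S / ln 2"
      using th by simp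
    finally show ?thesis
      using le False by (simp add: fdma_rate_def log_def)
  qed
qed

text \<open>The full-bandwidth case \<open>\<theta> = 1\<close> of the previous bound.\<close>

lemma user_rate_le:
  assumes "q \<in> feasible S N" "0 \<le> Pk" "Pk \<le> total_power S"
  shows "user_rate S N k Pk q \<le> rate_bound N"
  using fdma_rate_le [of q N Pk 1 k] assms by (simp add: fdma_rate_def user_rate_def)

lemma best_rate_le:
  assumes "0 \<le> Pk" "Pk \<le> total_power S"
  shows "best_rate S N k Pk \<le> rate_bound N"
  unfolding best_rate_def
  using feasible_nonempty user_rate_le assms by (intro cSUP_least) auto

lemma best_rate_nonneg:
  assumes "0 \<le> Pk" "Pk \<le> total_power S"
  shows "0 \<le> best_rate S N k Pk"
proof -
  obtain q where q: "q \<in> feasible S N" using feasible_nonempty by blast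
  \<comment> \<open>Boundedness lets the real supremum be compared with its value at a single
    placement.\<close>
  have "bdd_above ((\<lambda>q. user_rate S N k Pk q) ` feasible S N)"
    using user_rate_le assms by (intro bdd_aboveI2 [where M = "rate_bound N"]) auto
  then show ?thesis
    unfolding best_rate_def using q user_rate_nonneg [OF assms(1)]
    by (intro cSUP_upper2) auto
qed

section \<open>Uplink regions inside a common box\<close>

lemma uplink_capacity_bounds:
  assumes "0 \<le> P1" "P1 \<le> total_power S" "0 \<le> P2" "P2 \<le> total_power S"
  shows "(0, 0) \<in> uplink_capacity S N P1 P2"
    and "uplink_capacity S N P1 P2 \<subseteq> {0..rate_bound N} \<times> {0..rate_bound N}"
proof -
  obtain q where q: "q \<in> feasible S N" using feasible_nonempty by blast
  have "0 \<le> (P1 * channel_gain S N 1 q + P2 * channel_gain S N 2 q) / noise S"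
    using assms valid channel_gain_nonneg [of N _ q] by (simp add: valid_system_def)
  then have "0 \<le> log 2 (1 + (P1 * channel_gain S N 1 q + P2 * channel_gain S N 2 q) / noise S)"
    by simp
  then have "(0, 0) \<in> uplink_capacity_at S N P1 P2 q"
    using assms user_rate_nonneg by (simp add: uplink_capacity_at_def)
  with q show "(0, 0) \<in> uplink_capacity S N P1 P2"
    unfolding uplink_capacity_def by (blast intro: hull_inc)
  \<comment> \<open>The box is convex, so it contains the hull once it contains the region of each
    placement; there the single-user constraints apply.\<close>
  show "uplink_capacity S N P1 P2 \<subseteq> {0..rate_bound N} \<times> {0..rate_bound N}"
    unfolding uplink_capacity_def
    using assms
    by (intro hull_minimal convex_Times convex_real_interval)
       (auto simp: uplink_capacity_at_def intro: order.trans [OF _ user_rate_le])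
qed

lemma uplink_tdma_bounds:
  assumes "0 \<le> P1" "P1 \<le> total_power S" "0 \<le> P2" "P2 \<le> total_power S"
  shows "(0, 0) \<in> uplink_tdma S N P1 P2"
    and "uplink_tdma S N P1 P2 \<subseteq> {0..rate_bound N} \<times> {0..rate_bound N}"
proof -
  note b = best_rate_nonneg [OF assms(1,2)] best_rate_nonneg [OF assms(3,4)]
  show "(0, 0) \<in> uplink_tdma S N P1 P2"
    using b unfolding uplink_tdma_def by (auto intro!: bexI [of _ 0])
  \<comment> \<open>Shrinking by a time share lowers \<open>r\<close> only when \<open>r\<close> is
    nonnegative, which is where \<open>best_rate_nonneg\<close> enters.\<close>
  have scale: "\<rho> * r \<le> rate_bound N" if "0 \<le> \<rho>" "\<rho> \<le> 1" "0 \<le> r" "r \<le> rate_bound N" for \<rho> r :: real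
    using mult_left_le_one_le [of r \<rho>] that by linarith
  show "uplink_tdma S N P1 P2 \<subseteq> {0..rate_bound N} \<times> {0..rate_bound N}"
  proof
    fix z assume "z \<in> uplink_tdma S N P1 P2"
    then obtain \<rho> R1 R2 where z: "z = (R1, R2)" and \<rho>: "0 \<le> \<rho>" "\<rho> \<le> 1"
      and R: "0 \<le> R1" "R1 \<le> \<rho> * best_rate S N 1 P1" "0 \<le> R2" "R2 \<le> (1 - \<rho>) * best_rate S N 2 P2"
      by (auto simp: uplink_tdma_def)
    have "\<rho> * best_rate S N 1 P1 \<le> rate_bound N" "(1 - \<rho>) * best_rate S N 2 P2 \<le> rate_bound N"
      using \<rho> b best_rate_le assms by (auto intro!: scale)
    with R show "z \<in> {0..rate_bound N} \<times> {0..rate_bound N}"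
      unfolding z by simp
  qed
qed

lemma uplink_fdma_bounds:
  assumes "0 \<le> P1" "P1 \<le> total_power S" "0 \<le> P2" "P2 \<le> total_power S"
  shows "(0, 0) \<in> uplink_fdma S N P1 P2"
    and "uplink_fdma S N P1 P2 \<subseteq> {0..rate_bound N} \<times> {0..rate_bound N}"
proof -
  obtain q where q: "q \<in> feasible S N" using feasible_nonempty by blast
  have "(0, 0) \<in> {(R1, R2). 0 \<le> R1 \<and> R1 \<le> fdma_rate S N 1 P1 0 q \<and>
                   0 \<le> R2 \<and> R2 \<le> fdma_rate S N 2 P2 (1 - 0) q}"
    using assms fdma_rate_nonneg by simp
  with q show "(0, 0) \<in> uplink_fdma S N P1 P2"
    unfolding uplink_fdma_def by (intro hull_inc) (auto intro!: bexI [of _ q] bexI [of _ 0])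
  show "uplink_fdma S N P1 P2 \<subseteq> {0..rate_bound N} \<times> {0..rate_bound N}"
    unfolding uplink_fdma_def
  proof (intro hull_minimal convex_Times convex_real_interval subsetI)
    fix z assume "z \<in> (\<Union>q\<in>feasible S N. \<Union>\<rho>\<in>{0..1}.
        {(R1, R2). 0 \<le> R1 \<and> R1 \<le> fdma_rate S N 1 P1 \<rho> q \<and>
                   0 \<le> R2 \<and> R2 \<le> fdma_rate S N 2 P2 (1 - \<rho>) q})"
    then obtain q \<rho> R1 R2 where z: "z = (R1, R2)" and q: "q \<in> feasible S N"
      and \<rho>: "0 \<le> \<rho>" "\<rho> \<le> 1"
      and R: "0 \<le> R1" "R1 \<le> fdma_rate S N 1 P1 \<rho> q" "0 \<le> R2" "R2 \<le> fdma_rate S N 2 P2 (1 - \<rho>) q"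
      by auto
    have "fdma_rate S N 1 P1 \<rho> q \<le> rate_bound N" "fdma_rate S N 2 P2 (1 - \<rho>) q \<le> rate_bound N"
      using q \<rho> assms by (auto intro!: fdma_rate_le)
    with R show "z \<in> {0..rate_bound N} \<times> {0..rate_bound N}"
      unfolding z by simp
  qed
qed

section \<open>Passage to the downlink regions\<close>

text \<open>Stated for an arbitrary family \<open>U\<close> so that all three schemes share one
  argument. A nonnegative power split of \<open>total_power S\<close> keeps each power below the
  total, so every uplink region lies in the box; convexity of the box carries this to the
  hull.\<close>

lemma downlink_shrinks:
  assumes origin: "\<And>N P1 P2. \<lbrakk>0 \<le> P1; P1 \<le> total_power S; 0 \<le> P2; P2 \<le> total_power S\<rbrakk>
      \<Longrightarrow> (0, 0) \<in> U N P1 P2"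
    and box: "\<And>N P1 P2. \<lbrakk>0 \<le> P1; P1 \<le> total_power S; 0 \<le> P2; P2 \<le> total_power S\<rbrakk>
      \<Longrightarrow> U N P1 P2 \<subseteq> {0..rate_bound N} \<times> {0..rate_bound N}"
  shows "shrinks_to_origin (\<lambda>N. downlink S (U N))"
proof -
  have P: "total_power S > 0" using valid by (auto simp: valid_system_def)
  have sub: "downlink S (U N) \<subseteq> {0..rate_bound N} \<times> {0..rate_bound N}" for N
    unfolding downlink_def
  proof (intro hull_minimal convex_Times convex_real_interval)
    show "(\<Union>(P1, P2)\<in>{(P1, P2). 0 \<le> P1 \<and> 0 \<le> P2 \<and> P1 + P2 = total_power S}. U N P1 P2)
      \<subseteq> {0..rate_bound N} \<times> {0..rate_bound N}"
      using box by fastforce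
  qed
  \<comment> \<open>One admissible split suffices: all power goes to user 2.\<close>
  have "(0, 0) \<in> U N 0 (total_power S)" for N
    using origin P by simp
  then have origin_in: "(0, 0) \<in> downlink S (U N)" for N
    unfolding downlink_def using P
    by (intro hull_inc, rule_tac a = "(0, total_power S)" in UN_I) simp_all
  have lim: "\<exists>N0. \<forall>N\<ge>N0. downlink S (U N) \<subseteq> {0..\<epsilon>} \<times> {0..\<epsilon>}" if "\<epsilon> > 0" for \<epsilon>
  proof -
    from order_tendstoD(2) [OF rate_bound_tendsto_0 that]
    obtain N0 where "\<forall>N\<ge>N0. rate_bound N < \<epsilon>"
      by (auto simp: eventually_sequentially)
    then have "{0..rate_bound N} \<times> {0..rate_bound N} \<subseteq> {0..\<epsilon>} \<times> {0..\<epsilon>}" if "N \<ge> N0" for N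
      using that by (intro Sigma_mono) (auto intro: order.trans less_imp_le)
    with sub show ?thesis by (blast intro: order.trans)
  qed
  have "{0..rate_bound N} \<times> {0..rate_bound N} \<subseteq> {0..} \<times> {0..}" for N
    by auto
  with sub have "downlink S (U N) \<subseteq> {0..} \<times> {0..}" for N
    by (rule order.trans)
  with origin_in lim show ?thesis
    unfolding shrinks_to_origin_def by simp
qed

end

theorem mainTheorem9:
  fixes S :: pinching_system
  assumes "valid_system S"
  shows "shrinks_to_origin (downlink_tdma S) \<and>
         shrinks_to_origin (downlink_fdma S) \<and>
         shrinks_to_origin (downlink_capacity S)"
proof (intro conjI)
  show "shrinks_to_origin (downlink_tdma S)"
    unfolding downlink_tdma_def [abs_def]
    by (rule downlink_shrinks [OF assms]) (rule uplink_tdma_bounds [OF assms]; assumption)+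
  show "shrinks_to_origin (downlink_fdma S)"
    unfolding downlink_fdma_def [abs_def]
    by (rule downlink_shrinks [OF assms]) (rule uplink_fdma_bounds [OF assms]; assumption)+
  show "shrinks_to_origin (downlink_capacity S)"
    unfolding downlink_capacity_def [abs_def]
    by (rule downlink_shrinks [OF assms]) (rule uplink_capacity_bounds [OF assms]; assumption)+
qed

end
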